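(* Let $p<q$ be primes. The polynomial $I(\varGamma(\mathbb{Z}_{pq}),x)$ is log-concave and unimodal.
   Context: For a positive integer $n$, the zero divisor graph $\varGamma(\mathbb{Z}_n)$ is the simple undirected graph whose vertices are the non-zero zero divisors of the ring $\mathbb{Z}_n$ of integers modulo $n$ (non-zero $a$ such that $ab=0$ for some non-zero $b$), two distinct vertices $a,b$ being adjacent if and only if $ab=0$ in $\mathbb{Z}_n$. An independent set of a finite graph $G$ is a set of vertices no two of which are adjacent (the empty set included); $\alpha(G)$ is the maximum size of an independent set, and $s_k(G)$ is the number of independent sets of size $k$. The independence polynomial of $G$ is $I(G,x)=\sum_{k=0}^{\alpha(G)} s_k(G)x^k$. A polynomial $\sum_{i=0}^{n}\ell_i x^i$ (of degree $n$) is log-concave if $\ell_j^2\ge \ell_{j-1}\ell_{j+1}$ for all $1\le j\le n-1$; it is unimodal if there is an index $m$, $0\le m\le n$, with $\ell_0\le \ell_1\le\dots\le \ell_m\ge \ell_{m+1}\ge\dots\ge \ell_n$. *)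

theory Defs
  imports
    "HOL-Number_Theory.Residues"
    "HOL-Computational_Algebra.Polynomial"
    "Graph_Theory.Pair_Digraph"
begin

section \<open>Zero divisor graphs\<close>

text \<open>Following the literature on zero divisor graphs, only non-zero elements count as
  vertices. The definition is one-sided, which is harmless for commutative rings.\<close>

definition nonzero_zero_divisors :: "('a, 'b) ring_scheme \<Rightarrow> 'a set" where
  "nonzero_zero_divisors R =
     {a \<in> carrier R - {\<zero>\<^bsub>R\<^esub>}. \<exists>b \<in> carrier R - {\<zero>\<^bsub>R\<^esub>}. a \<otimes>\<^bsub>R\<^esub> b = \<zero>\<^bsub>R\<^esub>}"

text \<open>An undirected edge between \<open>a\<close> and \<open>b\<close> is represented by the two arcs \<open>(a, b)\<close> and
  \<open>(b, a)\<close>.\<close>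

definition zero_divisor_graph :: "('a, 'b) ring_scheme \<Rightarrow> 'a pair_pre_digraph" where
  "zero_divisor_graph R =
     \<lparr>pverts = nonzero_zero_divisors R,
      parcs = {(a, b). a \<in> nonzero_zero_divisors R \<and> b \<in> nonzero_zero_divisors R \<and>
                       a \<noteq> b \<and> a \<otimes>\<^bsub>R\<^esub> b = \<zero>\<^bsub>R\<^esub>}\<rparr>"

lemma pair_graph_zero_divisor_graph_residue_ring:
  "pair_graph (zero_divisor_graph (residue_ring m))"
proof -
  let ?V = "nonzero_zero_divisors (residue_ring m)"
  have fin: "finite ?V"
    by (rule finite_subset[of _ "{0..m - 1}"])
       (auto simp: nonzero_zero_divisors_def residue_ring_def)
  have "finite (parcs (zero_divisor_graph (residue_ring m)))"
    by (rule finite_subset[of _ "?V \<times> ?V"]) (auto simp: zero_divisor_graph_def fin)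
  with fin show ?thesis
    by unfold_locales
       (auto simp: zero_divisor_graph_def symmetric_def sym_def residue_ring_def mult.commute)
qed


section \<open>Independence polynomials\<close>

definition independent_set :: "'a pair_pre_digraph \<Rightarrow> 'a set \<Rightarrow> bool" where
  "independent_set G S \<longleftrightarrow> S \<subseteq> pverts G \<and> (\<forall>u\<in>S. \<forall>v\<in>S. (u, v) \<notin> parcs G)"

definition independence_number :: "'a pair_pre_digraph \<Rightarrow> nat" where
  "independence_number G = Max (card ` {S. independent_set G S})"

definition num_independent_sets :: "'a pair_pre_digraph \<Rightarrow> nat \<Rightarrow> nat" where
  "num_independent_sets G k = card {S. independent_set G S \<and> card S = k}"

definition independence_poly :: "'a pair_pre_digraph \<Rightarrow> int poly" where
  "independence_poly G =
     (\<Sum>k = 0..independence_number G. monom (int (num_independent_sets G k)) k)"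


section \<open>Log-concave and unimodal polynomials\<close>

definition log_concave_poly :: "'a::linordered_idom poly \<Rightarrow> bool" where
  "log_concave_poly P \<longleftrightarrow>
     (\<forall>j. 1 \<le> j \<and> j < degree P \<longrightarrow> (coeff P j)\<^sup>2 \<ge> coeff P (j - 1) * coeff P (j + 1))"

definition unimodal_poly :: "'a::linordered_idom poly \<Rightarrow> bool" where
  "unimodal_poly P \<longleftrightarrow>
     (\<exists>m \<le> degree P.
        (\<forall>i. i < m \<longrightarrow> coeff P i \<le> coeff P (i + 1)) \<and>
        (\<forall>i. m \<le> i \<and> i < degree P \<longrightarrow> coeff P i \<ge> coeff P (i + 1)))"

end

theory Submission
  imports Defs
begin

text \<open>The vertices of \<open>\<Gamma>(\<int>\<^bsub>pq\<^esub>)\<close> are the nonzero multiples of \<open>p\<close> and of \<open>q\<close>, and the graph is complete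
  bipartite between these two classes of sizes \<open>q - 1\<close> and \<open>p - 1\<close>. Hence its independence
  polynomial is \<open>(1 + x)\<^sup>a + (1 + x)\<^sup>b - 1\<close> with \<open>a = p - 1 < b = q - 1\<close>. Up to the constant term, which
  occurs only on the smaller side of the log-concavity inequalities, this is
  \<open>(1 + x)\<^sup>a (1 + (1 + x)\<^bsup>b-a\<^esup>)\<close>. The second factor is log-concave, and multiplication by \<open>1 + x\<close>
  preserves log-concavity.\<close>

subsection \<open>Log-concave sequences\<close>

text \<open>For nonnegative sequences this is log-concavity together with the absence of internal zeros;
  the case \<open>i = j\<close> alone would not be stable under multiplication by \<open>1 + x\<close>.\<close>

definition log_concave_seq :: "(nat \<Rightarrow> nat) \<Rightarrow> bool" where
  "log_concave_seq f \<longleftrightarrow> (\<forall>i j. i \<le> j \<longrightarrow> f i * f (Suc (Suc j)) \<le> f (Suc i) * f (Suc j))"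

lemma log_concave_seqD:
  "log_concave_seq f \<Longrightarrow> i \<le> j \<Longrightarrow> f i * f (Suc (Suc j)) \<le> f (Suc i) * f (Suc j)"
  by (simp add: log_concave_seq_def)

text \<open>The hypotheses say that \<open>g\<close> is the coefficient sequence of \<open>(1 + x) \<Sum>\<^sub>k f\<^sub>k x\<^sup>k\<close>.\<close>

lemma log_concave_seq_Pascal:
  assumes f: "log_concave_seq f" and g0: "g 0 = f 0" and gS: "\<And>k. g (Suc k) = f (Suc k) + f k"
  shows "log_concave_seq g"
  unfolding log_concave_seq_def
proof (intro allI impI)
  fix i j :: nat
  assume ij: "i \<le> j"
  have 1: "f i * f (Suc (Suc j)) \<le> f (Suc i) * f (Suc j)"
    using log_concave_seqD[OF f ij] .
  \<comment> \<open>For \<open>i < j\<close> this is log-concavity at \<open>i\<close> and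
    \<open>j - 1\<close>; for \<open>i = j\<close> both sides coincide.\<close>
  have 2: "f i * f (Suc j) \<le> f (Suc i) * f j"
  proof (cases "i = j")
    case False
    then obtain j' where "j = Suc j'" "i \<le> j'"
      using ij by (cases j) auto
    then show ?thesis
      using log_concave_seqD[OF f, of i j'] by simp
  qed simp
  \<comment> \<open>After expansion, each product on the left is bounded by a different product on
    the right: \<open>1\<close> and \<open>2\<close> treat those with \<open>f i\<close>, further
    bounds those with \<open>f (i - 1)\<close>, which are absent for \<open>i = 0\<close>.\<close>
  show "g i * g (Suc (Suc j)) \<le> g (Suc i) * g (Suc j)"
  proof (cases i)
    case 0
    then show ?thesis
      using 1 2 by (simp add: g0 gS algebra_simps)
  next
    case (Suc i')
    obtain j' where j: "j = Suc j'" "i' \<le> j'"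
      using ij Suc by (cases j) auto
    have 3: "f i' * f (Suc j) \<le> f i * f j"
      using log_concave_seqD[OF f, of i' j'] j Suc by simp
    have 4: "f i' * f (Suc (Suc j)) \<le> f i * f (Suc j)"
      using log_concave_seqD[OF f, of i' j] j Suc by simp
    have gi: "g i = f i + f i'"
      by (simp add: Suc gS)
    show ?thesis
      using 1 2 3 4 by (simp add: gi gS algebra_simps)
  qed
qed

lemma log_concave_seq_binomial: "log_concave_seq (\<lambda>k. n choose k)"
proof (induction n)
  case 0
  then show ?case
    by (simp add: log_concave_seq_def)
next
  case (Suc n)
  show ?case
    by (rule log_concave_seq_Pascal[OF Suc]) simp_all
qed

text \<open>Raising \<open>a\<close> with \<open>c\<close> fixed multiplies the whole sum by
  \<open>1 + x\<close>. This leaves \<open>1 + (1 + x)^c\<close>, which differs from a binomial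
  power only in its constant coefficient 2.\<close>

lemma log_concave_seq_binomial_add:
  "log_concave_seq (\<lambda>k. (a choose k) + (a + c choose k))"
proof (induction a)
  case 0
  \<comment> \<open>This settles \<open>i = 0\<close>, where the doubled constant coefficient
    enters; the factor 2 is absorbed by \<open>j + 2\<close>.\<close>
  have "2 * (c choose Suc (Suc j)) \<le> c * (c choose Suc j)" for j
  proof -
    have "2 * (c choose Suc (Suc j)) \<le> Suc (Suc j) * (c choose Suc (Suc j))"
      by simp
    also have "\<dots> = (c choose Suc j) * (c - Suc j)"
      by (metis binomial_absorb_comp binomial_absorption mult.commute)
    also have "\<dots> \<le> (c choose Suc j) * c"
      by simp
    finally show ?thesis
      by (simp add: mult.commute)
  qed
  then have "((0 choose i) + (c choose i)) * (c choose Suc (Suc j)) \<le>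
      (c choose Suc i) * (c choose Suc j)"
    if "i \<le> j" for i j
    using log_concave_seqD[OF log_concave_seq_binomial that, of c]
    by (cases i) (simp_all add: numeral_2_eq_2)
  then show ?case
    by (simp add: log_concave_seq_def)
next
  case (Suc a)
  show ?case
    by (rule log_concave_seq_Pascal[OF Suc]) simp_all
qed


subsection \<open>Unimodality\<close>

text \<open>With positive coefficients, log-concavity makes the ratios of consecutive coefficients
  nonincreasing, so no ascent follows the first descent.\<close>

lemma unimodal_poly_if_log_concave_poly:
  fixes P :: "'a::linordered_idom poly"
  assumes lc: "log_concave_poly P" and pos: "\<And>i. i \<le> degree P \<Longrightarrow> coeff P i > 0"
  shows "unimodal_poly P"
proof -
  define m where "m = (LEAST k. k = degree P \<or> coeff P (k + 1) < coeff P k)"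
  have m: "m = degree P \<or> coeff P (m + 1) < coeff P m"
    unfolding m_def by (rule LeastI[of _ "degree P"]) simp
  have "m \<le> degree P"
    unfolding m_def by (rule Least_le) simp
  moreover have "coeff P i \<le> coeff P (i + 1)" if "i < m" for i
    using not_less_Least[OF that[unfolded m_def]] by simp
  moreover have "coeff P (i + 1) \<le> coeff P i" if "m \<le> i" "i < degree P" for i
    using that
  proof (induction i rule: dec_induct)
    case base
    then show ?case
      using m by auto
  next
    case (step i)
    \<comment> \<open>The induction hypothesis bounds one factor of the square by
      \<open>coeff P i\<close>, which is then cancelled.\<close>
    have "coeff P i * coeff P (Suc i + 1) \<le> (coeff P (Suc i))\<^sup>2"
      using lc step.prems unfolding log_concave_poly_def
      by (metis One_nat_def diff_Suc_1 le_add1 plus_1_eq_Suc)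
    also have "\<dots> \<le> coeff P i * coeff P (Suc i)"
      using step pos[of "Suc i"] by (simp add: power2_eq_square mult_right_mono)
    finally show ?case
      using pos[of i] step.prems by simp
  qed
  ultimately show ?thesis
    unfolding unimodal_poly_def by blast
qed


subsection \<open>Independence polynomials\<close>

text \<open>Beyond the independence number, where the defining sum stops, both sides vanish.\<close>

lemma coeff_independence_poly:
  assumes "finite (pverts G)"
  shows "coeff (independence_poly G) k = int (num_independent_sets G k)"
proof -
  have fin: "finite {S. independent_set G S}"
    by (rule finite_subset[of _ "Pow (pverts G)"]) (auto simp: independent_set_def assms)
  have "num_independent_sets G k = 0" if "k > independence_number G"
  proof -
    have "card S \<le> independence_number G" if "independent_set G S" for S
      unfolding independence_number_def using fin that by (intro Max_ge) auto
    then have "{S. independent_set G S \<and> card S = k} = {}"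
      using that by fastforce
    then show ?thesis
      by (simp only: num_independent_sets_def card.empty)
  qed
  then show ?thesis
    by (auto simp: independence_poly_def coeff_sum if_distrib[of int] not_le[symmetric])
qed

text \<open>Only the empty set lies in both classes, so the two counts add up except at
  \<open>k = 0\<close>, where it must be counted once.\<close>

lemma num_independent_sets_complete_bipartite:
  assumes "finite A" "finite B" "A \<inter> B = {}"
    and ind: "\<And>S. independent_set G S \<longleftrightarrow> S \<subseteq> A \<or> S \<subseteq> B"
  shows "num_independent_sets G k =
           (if k = 0 then 1 else (card A choose k) + (card B choose k))"
proof (cases "k = 0")
  case True
  have "{S. independent_set G S \<and> card S = 0} = {{}}"
    using assms finite_subset by (auto simp: ind card_eq_0_iff)
  then show ?thesis
    using True by (simp add: num_independent_sets_def)
next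
  case False
  let ?X = "{S. S \<subseteq> A \<and> card S = k}" and ?Y = "{S. S \<subseteq> B \<and> card S = k}"
  have "?X \<inter> ?Y = {}"
  proof -
    have "card S \<noteq> k" if "S \<subseteq> A" "S \<subseteq> B" for S
    proof -
      have "S = {}"
        using that assms(3) by blast
      then show ?thesis
        using False by simp
    qed
    then show ?thesis
      by blast
  qed
  moreover have "{S. independent_set G S \<and> card S = k} = ?X \<union> ?Y"
    by (auto simp: ind)
  moreover have "finite ?X" "finite ?Y"
    using assms by auto
  ultimately show ?thesis
    using False assms by (simp add: num_independent_sets_def card_Un_disjoint n_subsets)
qed


subsection \<open>The zero divisor graph of a product of two primes\<close>

lemma nonzero_zero_divisors_residue_ring:
  "nonzero_zero_divisors (residue_ring n) = {a \<in> {0<..<n}. \<exists>b\<in>{0<..<n}. n dvd a * b}"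
proof -
  have "carrier (residue_ring n) - {\<zero>\<^bsub>residue_ring n\<^esub>} = {0<..<n}"
    by (auto simp: residue_ring_def)
  then show ?thesis
    unfolding nonzero_zero_divisors_def by (simp add: residue_ring_def dvd_eq_mod_eq_0)
qed

definition nonzero_multiples_below :: "int \<Rightarrow> int \<Rightarrow> int set" where
  "nonzero_multiples_below n p = {x \<in> {0<..<n}. p dvd x}"

lemma finite_nonzero_multiples_below [simp]: "finite (nonzero_multiples_below n p)"
  by (rule finite_subset[of _ "{0<..<n}"]) (auto simp: nonzero_multiples_below_def)

lemma card_nonzero_multiples_below:
  assumes "p > 0"
  shows "card (nonzero_multiples_below (p * q) p) = nat (q - 1)"
proof -
  have "nonzero_multiples_below (p * q) p = (*) p ` {0<..<q}"
    using assms by (auto simp: nonzero_multiples_below_def zero_less_mult_iff elim!: dvdE)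
  moreover have "inj_on ((*) p) {0<..<q}"
    using assms by (auto intro: inj_onI)
  ultimately show ?thesis
    by (simp add: card_image)
qed

context
  fixes p q :: int
  assumes prime: "prime p" "prime q" and neq: "p \<noteq> q"
begin

private lemma pos: "p > 0" "q > 0"
  using prime by (auto simp: prime_gt_0_int)

private lemma mult_dvd_iff: "p * q dvd x \<longleftrightarrow> p dvd x \<and> q dvd x"
  using primes_coprime[OF prime neq] by (auto intro: divides_mult dvd_mult_left dvd_mult_right)

private lemma not_dvd_both: "0 < x \<Longrightarrow> x < p * q \<Longrightarrow> \<not> (p dvd x \<and> q dvd x)"
  using zdvd_imp_le[of "p * q" x] by (auto simp flip: mult_dvd_iff)

lemma nonzero_multiples_below_disjoint:
  "nonzero_multiples_below (p * q) p \<inter> nonzero_multiples_below (p * q) q = {}"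
  using not_dvd_both by (auto simp: nonzero_multiples_below_def)

lemma nonzero_zero_divisors_residue_ring_mult_primes:
  "nonzero_zero_divisors (residue_ring (p * q)) =
     nonzero_multiples_below (p * q) p \<union> nonzero_multiples_below (p * q) q"
  (is "?V = ?A \<union> ?B")
proof (intro equalityI subsetI)
  fix x assume "x \<in> ?V"
  then obtain y where x: "0 < x" "x < p * q" and y: "0 < y" "y < p * q" "p * q dvd x * y"
    by (auto simp: nonzero_zero_divisors_residue_ring)
  \<comment> \<open>Otherwise both primes would divide \<open>y\<close>, which lies strictly between
    0 and \<open>p * q\<close>.\<close>
  have "p dvd x \<or> q dvd x"
    using y not_dvd_both[of y] prime by (auto simp: mult_dvd_iff prime_dvd_mult_iff)
  then show "x \<in> ?A \<union> ?B"
    using x by (auto simp: nonzero_multiples_below_def)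
next
  \<comment> \<open>Multiples of \<open>p\<close> are annihilated by \<open>q\<close> and
    conversely; both witnesses are nonzero residues because the other prime exceeds 1.\<close>
  have p: "p < p * q" and q: "q < p * q"
    using prime pos prime_gt_1_int by auto
  fix x assume "x \<in> ?A \<union> ?B"
  then have x: "0 < x" "x < p * q" and "p dvd x \<or> q dvd x"
    by (auto simp: nonzero_multiples_below_def)
  from \<open>p dvd x \<or> q dvd x\<close> have "p * q dvd x * q \<or> p * q dvd x * p"
    by (auto simp: mult_dvd_iff)
  moreover have "p \<in> {0<..<p * q}" "q \<in> {0<..<p * q}"
    using p q pos by (simp_all only: greaterThanLessThan_iff)
  ultimately have "\<exists>y\<in>{0<..<p * q}. p * q dvd x * y"
    by blast
  then show "x \<in> ?V"
    using x by (simp only: nonzero_zero_divisors_residue_ring mem_Collect_eq greaterThanLessThan_iff)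
qed

text \<open>A product of two vertices vanishes exactly when they lie in different classes, so a set
  meeting both classes contains an edge.\<close>

lemma independent_set_zero_divisor_graph_mult_primes:
  "independent_set (zero_divisor_graph (residue_ring (p * q))) S \<longleftrightarrow>
     S \<subseteq> nonzero_multiples_below (p * q) p \<or> S \<subseteq> nonzero_multiples_below (p * q) q"
  (is "_ \<longleftrightarrow> S \<subseteq> ?A \<or> S \<subseteq> ?B")
proof -
  have "p * q dvd x * y \<longleftrightarrow> (x \<in> ?A \<longleftrightarrow> y \<in> ?B)" if "x \<in> ?A \<union> ?B" "y \<in> ?A \<union> ?B" for x y
  proof -
    have "p * q dvd x * y \<longleftrightarrow> (p dvd x \<or> p dvd y) \<and> (q dvd x \<or> q dvd y)"
      using prime by (simp add: mult_dvd_iff prime_dvd_mult_iff)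
    then show ?thesis
      using that not_dvd_both[of x] not_dvd_both[of y] by (auto simp: nonzero_multiples_below_def)
  qed
  moreover have "x \<otimes>\<^bsub>residue_ring (p * q)\<^esub> y = x * y mod (p * q)"
      "\<zero>\<^bsub>residue_ring (p * q)\<^esub> = 0" for x y
    by (simp_all add: residue_ring_def)
  ultimately have "(x, y) \<in> parcs (zero_divisor_graph (residue_ring (p * q))) \<longleftrightarrow>
      x \<in> ?A \<union> ?B \<and> y \<in> ?A \<union> ?B \<and> x \<noteq> y \<and> (x \<in> ?A \<longleftrightarrow> y \<in> ?B)" for x y
    by (auto simp: zero_divisor_graph_def nonzero_zero_divisors_residue_ring_mult_primes
        simp flip: dvd_eq_mod_eq_0)
  \<comment> \<open>The condition \<open>x \<noteq> y\<close> is absorbed because the classes are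
    disjoint.\<close>
  then have edge: "(x, y) \<in> parcs (zero_divisor_graph (residue_ring (p * q))) \<longleftrightarrow>
      x \<in> ?A \<and> y \<in> ?B \<or> x \<in> ?B \<and> y \<in> ?A" for x y
    using nonzero_multiples_below_disjoint by blast
  show ?thesis
    using nonzero_multiples_below_disjoint
    unfolding independent_set_def edge
    by (simp add: zero_divisor_graph_def nonzero_zero_divisors_residue_ring_mult_primes) blast
qed

lemma coeff_independence_poly_zero_divisor_graph_mult_primes:
  "coeff (independence_poly (zero_divisor_graph (residue_ring (p * q)))) k =
     (if k = 0 then 1 else int ((nat (q - 1) choose k) + (nat (p - 1) choose k)))"
proof -
  have "finite (pverts (zero_divisor_graph (residue_ring (p * q))))"
    by (simp add: zero_divisor_graph_def nonzero_zero_divisors_residue_ring_mult_primes)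
  moreover have "card (nonzero_multiples_below (p * q) q) = nat (p - 1)"
    using card_nonzero_multiples_below[OF pos(2), of p] by (simp add: mult.commute)
  ultimately show ?thesis
    by (simp add: coeff_independence_poly card_nonzero_multiples_below[OF pos(1)]
        num_independent_sets_complete_bipartite[OF _ _ nonzero_multiples_below_disjoint
          independent_set_zero_divisor_graph_mult_primes])
qed

end

theorem theorem2p5:
  fixes p q :: nat
  assumes "prime p" and "prime q" and "p < q"
  shows "log_concave_poly (independence_poly (zero_divisor_graph (residue_ring (int (p * q)))))
       \<and> unimodal_poly (independence_poly (zero_divisor_graph (residue_ring (int (p * q)))))"
proof -
  define P where "P = independence_poly (zero_divisor_graph (residue_ring (int (p * q))))"
  define a b where "a = p - 1" and "b = q - 1"
  define s where "s k = (a choose k) + (b choose k)" for k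
  have ab: "a < b"
    using assms prime_gt_0_nat[of p] by (simp add: a_def b_def)
  have nat: "nat (int r - 1) = r - 1" for r
    by arith
  have coeff: "coeff P k = (if k = 0 then 1 else int (s k))" for k
    using coeff_independence_poly_zero_divisor_graph_mult_primes[of "int p" "int q" k] assms
    by (simp add: P_def s_def a_def b_def nat add.commute)
  have s: "log_concave_seq s"
    using log_concave_seq_binomial_add[of a "b - a"] ab by (simp add: s_def[abs_def])
  \<comment> \<open>Since \<open>a < b\<close>, the larger class determines the degree.\<close>
  have deg: "degree P = b"
  proof (rule antisym)
    show "degree P \<le> b"
      using ab by (intro degree_le) (auto simp: coeff s_def binomial_eq_0)
    show "b \<le> degree P"
      using ab by (intro le_degree) (auto simp: coeff s_def)
  qed
  have pos: "coeff P i > 0" if "i \<le> degree P" for i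
    using that by (auto simp: coeff deg s_def intro: add_nonneg_pos)
  have "log_concave_poly P"
    unfolding log_concave_poly_def
  proof (intro allI impI)
    fix j assume "1 \<le> j \<and> j < degree P"
    then obtain i where j: "j = Suc i"
      by (cases j) auto
    \<comment> \<open>For \<open>j = 1\<close> the left side contains the constant term 1, whereas
      \<open>s 0 = 2\<close>; hence an inequality.\<close>
    have "coeff P (j - 1) * coeff P (j + 1) \<le> int (s i * s (Suc (Suc i)))"
      by (auto simp: coeff j s_def[of 0])
    also have "\<dots> \<le> int (s (Suc i) * s (Suc i))"
      using log_concave_seqD[OF s order_refl] by (simp only: of_nat_le_iff)
    also have "\<dots> = (coeff P j)\<^sup>2"
      by (simp add: coeff j power2_eq_square)
    finally show "coeff P (j - 1) * coeff P (j + 1) \<le> (coeff P j)\<^sup>2" .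
  qed
  then show ?thesis
    using unimodal_poly_if_log_concave_poly pos unfolding P_def by blast
qed

end
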